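(* Let $\mathbf A\in\mathbb R^{m\times n}$ and let $0\le s<\mathrm{rank}(\mathbf A)$ be an integer. Let $t_s=s+\mathrm{sr}_s(\mathbf A)$, let $0<\epsilon\le\frac12$, and let $k$ be an integer with $s+\frac{7}{\epsilon^4}\ln^2\frac1\epsilon\le k\le t_s-1$. If $S\sim k\text{-}\mathrm{DPP}(\mathbf A^\top\mathbf A)$, then \[ \frac{\mathbb E[\mathrm{Er}_{\mathbf A}(S)]}{\mathrm{OPT}_k}\le (1+2\epsilon)^2\,\Phi_s(k),\qquad\text{where}\quad \Phi_s(k)=\Big(1+\frac{s}{k-s}\Big)\sqrt{1+\frac{2(k-s)}{t_s-k}}. \]
   Context: For $\mathbf A\in\mathbb R^{m\times n}$ with columns $\mathbf a_1,\dots,\mathbf a_n$ and $S\subseteq\{1,\dots,n\}$, $\mathbf P_S$ denotes the orthogonal projection onto $\mathrm{span}\{\mathbf a_i:i\in S\}$ and $\mathrm{Er}_{\mathbf A}(S)=\|\mathbf A-\mathbf P_S\mathbf A\|_F^2$. $\mathrm{OPT}_k=\min_{\mathrm{rank}(\mathbf B)=k}\|\mathbf A-\mathbf B\|_F^2=\sum_{i>k}\lambda_i$, where $\lambda_1\ge\lambda_2\ge\dots\ge\lambda_n$ are the eigenvalues of $\mathbf A^\top\mathbf A$. The stable rank of order $s$ (for $0\le s<\mathrm{rank}(\mathbf A)$) is $\mathrm{sr}_s(\mathbf A)=\lambda_{s+1}^{-1}\sum_{i>s}\lambda_i$. For $\mathbf A_S$ the submatrix of columns indexed by $S$, $S\sim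 k\text{-}\mathrm{DPP}(\mathbf A^\top\mathbf A)$ denotes the distribution over subsets $S\subseteq\{1,\dots,n\}$ with $|S|=k$ and $\Pr(S)\propto\det(\mathbf A_S^\top\mathbf A_S)$. *)

theory Defs
  imports "HOL-Analysis.Analysis"
begin

definition orth_proj :: "(real^'m) set \<Rightarrow> real^'m \<Rightarrow> real^'m" where
  "orth_proj X v = (SOME p. p \<in> span X \<and> (\<forall>y\<in>span X. inner (v - p) y = 0))"

definition P_S :: "real^'n^'m \<Rightarrow> 'n set \<Rightarrow> real^'m \<Rightarrow> real^'m" where
  "P_S A S v = orth_proj ((\<lambda>i. column i A) ` S) v"

definition frob_sq :: "real^'n^'m \<Rightarrow> real" where
  "frob_sq M = (\<Sum>i\<in>UNIV. \<Sum>j\<in>UNIV. (M$i$j)^2)"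

definition Er :: "real^'n^'m \<Rightarrow> 'n set \<Rightarrow> real" where
  "Er A S = frob_sq (A - (\<chi> i j. (P_S A S (column j A)) $ i))"

text \<open>det(A_S^T A_S) via the Leibniz formula over permutations of S.\<close>
definition gram_det :: "real^'n^'m \<Rightarrow> 'n set \<Rightarrow> real" where
  "gram_det A S = (\<Sum>p\<in>{p. p permutes S}. of_int (sign p) * (\<Prod>i\<in>S. inner (column i A) (column (p i) A)))"

definition kdpp_expect :: "real^'n^'m \<Rightarrow> nat \<Rightarrow> ('n set \<Rightarrow> real) \<Rightarrow> real" where
  "kdpp_expect A k f =
     (\<Sum>S\<in>{S. card S = k}. gram_det A S * f S) / (\<Sum>S\<in>{S. card S = k}. gram_det A S)"

text \<open>Eigenvalues of A^T A with multiplicity, sorted decreasingly: lam 0 \<ge> lam 1 \<ge> ... \<ge> lam (n-1)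
  (lam i is \<lambda>_{i+1} in the paper).\<close>
definition sorted_eigs :: "real^'n^'m \<Rightarrow> (nat \<Rightarrow> real) \<Rightarrow> bool" where
  "sorted_eigs A lam \<longleftrightarrow>
     (\<forall>x::real. det (x *\<^sub>R mat 1 - transpose A ** A) = (\<Prod>i<CARD('n). (x - lam i))) \<and>
     (\<forall>i j. i \<le> j \<and> j < CARD('n) \<longrightarrow> lam j \<le> lam i)"

definition OPT :: "(nat \<Rightarrow> real) \<Rightarrow> nat \<Rightarrow> nat \<Rightarrow> real" where
  "OPT lam n k = (\<Sum>i\<in>{k..<n}. lam i)"

definition stable_rank :: "(nat \<Rightarrow> real) \<Rightarrow> nat \<Rightarrow> nat \<Rightarrow> real" where
  "stable_rank lam n s = (\<Sum>i\<in>{s..<n}. lam i) / lam s"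

end

(* By Cauchy-Binet, E[Er(S)] = (k+1) e_{k+1} / e_k for the elementary symmetric polynomials e_j of the
   eigenvalues: adding a column j to S multiplies the Gram determinant by the squared residual of a_j,
   and the sum of det(A_S^T A_S) over |S| = j is e_j.  By a weak Newton inequality this ratio decreases
   in k.  For alpha > 0 the numbers e_j / alpha^j are the weights of a Poisson binomial variable N with
   success probabilities lambda_i / (lambda_i + alpha); averaging the ratio over N bounds it at k by
   alpha E[N] / P(N <= k).  With alpha = (1 + 2 eps) gamma OPT_k / (k - s), where gamma is the square root
   in Phi_s(k), one has E[N] <= k, and a Chernoff bound gives P(N <= k) >= 1 / (1 + 2 eps). *)

theory Submission
  imports Defs "HOL-Computational_Algebra.Polynomial"
begin

subsection \<open>Gram determinants and projection residuals\<close>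

lemma orth_proj:
  fixes X :: "(real^'m) set"
  shows orth_proj_in_span: "orth_proj X v \<in> span X"
    and orth_proj_residual_orthogonal: "y \<in> span X \<Longrightarrow> inner (v - orth_proj X v) y = 0"
proof -
  obtain p q where "p \<in> span X" "\<And>w. w \<in> span X \<Longrightarrow> orthogonal q w" "v = p + q"
    using orthogonal_subspace_decomp_exists[of X v] by metis
  then have "\<exists>p. p \<in> span X \<and> (\<forall>y\<in>span X. inner (v - p) y = 0)"
    by (intro exI[of _ p]) (auto simp: orthogonal_def)
  from someI_ex[OF this]
  show "orth_proj X v \<in> span X" "y \<in> span X \<Longrightarrow> inner (v - orth_proj X v) y = 0"
    unfolding orth_proj_def by blast+
qed

definition col_residual :: "real^'n^'m \<Rightarrow> 'n set \<Rightarrow> 'n \<Rightarrow> real^'m" where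
  "col_residual A S j = column j A - P_S A S (column j A)"

lemma inner_col_residual:
  assumes "i \<in> S"
  shows "inner (col_residual A S j) (column i A) = 0"
  using assms by (auto simp: col_residual_def P_S_def intro!: orth_proj_residual_orthogonal span_base)

lemma inner_col_residual_self:
  "inner (col_residual A S j) (column j A) = (norm (col_residual A S j))\<^sup>2"
proof -
  have "inner (col_residual A S j) (P_S A S (column j A)) = 0"
    unfolding col_residual_def P_S_def
    by (rule orth_proj_residual_orthogonal[OF orth_proj_in_span])
  then show ?thesis
    by (simp add: power2_norm_eq_inner) (simp add: col_residual_def inner_diff_right)
qed

lemma col_residual_eq_0:
  assumes "j \<in> S"
  shows "col_residual A S j = 0"
  using inner_col_residual[OF assms, of A j] inner_col_residual_self[of A S j] by simp

lemma Er_eq_sum_col_residual: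
  "Er A S = (\<Sum>j\<in>-S. (norm (col_residual A S j))\<^sup>2)"
proof -
  have "Er A S = (\<Sum>j\<in>UNIV. \<Sum>i\<in>UNIV. (col_residual A S j $ i)\<^sup>2)"
    unfolding Er_def frob_sq_def by (subst sum.swap) (simp add: col_residual_def column_def)
  also have "\<dots> = (\<Sum>j\<in>UNIV. (norm (col_residual A S j))\<^sup>2)"
    by (simp only: power2_norm_eq_inner inner_vec_def) (simp add: power2_eq_square)
  also have "\<dots> = (\<Sum>j\<in>-S. (norm (col_residual A S j))\<^sup>2)"
    by (intro sum.mono_neutral_right) (auto simp: col_residual_eq_0)
  finally show ?thesis .
qed

text \<open>\<open>det\<close> needs a matrix indexed by a whole type, so the Gram matrix of
  \<open>S\<close> is padded with identity rows instead of being cut down to a smaller index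
  set.\<close>

definition gram_ext :: "real^'n^'m \<Rightarrow> 'n set \<Rightarrow> real^'n^'n" where
  "gram_ext A S = (\<chi> i j. if i \<in> S then inner (column i A) (column j A) else of_bool (i = j))"

text \<open>A permutation of \<open>T\<close> that fixes \<open>T - S\<close> pointwise is a
  permutation of \<open>S\<close>, so every discarded term moves a point of
  \<open>T - S\<close>.\<close>

lemma sum_permutes_subset:
  assumes "finite T" "S \<subseteq> T"
    and zero: "\<And>p i. p permutes T \<Longrightarrow> i \<in> T - S \<Longrightarrow> p i \<noteq> i \<Longrightarrow> f p = 0"
  shows "(\<Sum>p | p permutes T. f p) = (\<Sum>p | p permutes S. f p)"
proof (rule sum.mono_neutral_right)
  show "finite {p. p permutes T}" using assms(1) by (rule finite_permutations)
  show "{p. p permutes S} \<subseteq> {p. p permutes T}" using assms(2) by (auto intro: permutes_subset)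
  show "\<forall>p\<in>{p. p permutes T} - {p. p permutes S}. f p = 0"
    using zero permutes_superset by blast
qed

text \<open>Outside \<open>S\<close> the rows are those of the identity, so only permutations of \<open>S\<close> contribute.\<close>

lemma det_rows_outside_identity:
  fixes M :: "real^'n^'n"
  assumes "\<And>i j. i \<notin> S \<Longrightarrow> M $ i $ j = of_bool (i = j)"
  shows "det M = (\<Sum>p | p permutes S. of_int (sign p) * (\<Prod>i\<in>S. M $ i $ p i))"
proof -
  have "det M = (\<Sum>p | p permutes S. of_int (sign p) * (\<Prod>i\<in>UNIV. M $ i $ p i))"
    unfolding det_def
  proof (rule sum_permutes_subset)
    fix p :: "'n \<Rightarrow> 'n" and i
    assume "i \<in> UNIV - S" "p i \<noteq> i"
    then have "M $ i $ p i = 0" using assms by auto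
    then have "(\<Prod>i\<in>UNIV. M $ i $ p i) = 0" by (intro prod_zero) auto
    then show "of_int (sign p) * (\<Prod>i\<in>UNIV. M $ i $ p i) = 0" by simp
  qed auto
  also have "\<dots> = (\<Sum>p | p permutes S. of_int (sign p) * (\<Prod>i\<in>S. M $ i $ p i))"
  proof (rule sum.cong, rule refl)
    fix p assume "p \<in> {p. p permutes S}"
    then have "(\<Prod>i\<in>UNIV. M $ i $ p i) = (\<Prod>i\<in>S. M $ i $ p i)"
      by (intro prod.mono_neutral_right) (auto simp: assms permutes_not_in)
    then show "of_int (sign p) * (\<Prod>i\<in>UNIV. M $ i $ p i) = of_int (sign p) * (\<Prod>i\<in>S. M $ i $ p i)"
      by simp
  qed
  finally show ?thesis .
qed

lemma gram_det_eq_det: "gram_det A S = det (gram_ext A S)"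
  by (subst det_rows_outside_identity[of S]) (auto simp: gram_ext_def gram_det_def)

text \<open>Row \<open>j\<close> of the padded Gram matrix depends linearly on
  \<open>column j A\<close>. Replacing that column by its residual subtracts a combination of the
  rows indexed by \<open>S\<close>, which keeps the determinant; the new row vanishes on
  \<open>S\<close> and holds the squared residual at position \<open>j\<close>.\<close>

lemma gram_det_insert:
  fixes A :: "real^'n^'m"
  assumes j: "j \<notin> S"
  shows "gram_det A (insert j S) = gram_det A S * (norm (col_residual A S j))\<^sup>2"
proof -
  define M where "M = gram_ext A (insert j S)"
  define T where "T v = (\<chi> l. inner v (column l A))" for v :: "real^'m"
  have T: "linear T"
    by (rule linearI) (auto simp: T_def vec_eq_iff inner_add_left)
  have rowM: "row i M = T (column i A)" if "i \<in> insert j S" for i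
    using that by (auto simp: M_def T_def gram_ext_def row_def vec_eq_iff)
  define N where "N = (\<chi> k. if k = j then T (col_residual A S j) else row k M)"
  have "T (P_S A S (column j A)) \<in> T ` span ((\<lambda>i. column i A) ` S)"
    unfolding P_S_def by (intro imageI orth_proj_in_span)
  also have "\<dots> = span (T ` (\<lambda>i. column i A) ` S)"
    by (rule linear_span_image[OF T, symmetric])
  also have "\<dots> \<subseteq> span {row k M |k. k \<noteq> j}"
    using j by (intro span_mono) (force simp: rowM[symmetric])
  finally have "- T (P_S A S (column j A)) \<in> span {row k M |k. k \<noteq> j}"
    by (rule span_neg)
  then have "det (\<chi> k. if k = j then row j M + - T (P_S A S (column j A)) else row k M) = det M"
    by (intro det_row_span) (simp add: span_vec_eq)
  also have "row j M + - T (P_S A S (column j A)) = T (col_residual A S j)"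
    using linear_diff[OF T] by (simp add: rowM col_residual_def)
  finally have "det M = det N" by (simp add: N_def)
  also have "\<dots> = (\<Sum>p | p permutes insert j S. of_int (sign p) * (\<Prod>i\<in>insert j S. N $ i $ p i))"
    by (rule det_rows_outside_identity) (auto simp: N_def M_def gram_ext_def row_def)
  \<comment> \<open>A permutation moving \<open>j\<close> sends it into \<open>S\<close>, where row
    \<open>j\<close> of \<open>N\<close> is zero.\<close>
  also have "\<dots> = (\<Sum>p | p permutes S. of_int (sign p) * (\<Prod>i\<in>insert j S. N $ i $ p i))"
  proof (rule sum_permutes_subset)
    fix p i assume p: "p permutes insert j S" and "i \<in> insert j S - S" "p i \<noteq> i"
    then have "p j \<in> S" using permutes_in_image[OF p, of j] by auto
    then have "N $ j $ p j = 0"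
      by (simp add: N_def T_def inner_col_residual)
    then show "of_int (sign p) * (\<Prod>i\<in>insert j S. N $ i $ p i) = 0"
      using j by simp
  qed auto
  also have "\<dots> = (\<Sum>p | p permutes S. of_int (sign p) *
      (\<Prod>i\<in>S. inner (column i A) (column (p i) A)) * (norm (col_residual A S j))\<^sup>2)"
  proof (rule sum.cong, rule refl)
    fix p assume "p \<in> {p. p permutes S}"
    then have "p j = j" using j by (simp add: permutes_not_in)
    then have "N $ j $ p j = (norm (col_residual A S j))\<^sup>2"
      by (simp add: N_def T_def inner_col_residual_self)
    moreover have "(\<Prod>i\<in>S. N $ i $ p i) = (\<Prod>i\<in>S. inner (column i A) (column (p i) A))"
      using j by (intro prod.cong) (auto simp: N_def rowM T_def)
    ultimately show "of_int (sign p) * (\<Prod>i\<in>insert j S. N $ i $ p i) =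
       of_int (sign p) * (\<Prod>i\<in>S. inner (column i A) (column (p i) A)) * (norm (col_residual A S j))\<^sup>2"
      using j by simp
  qed
  finally show ?thesis
    by (simp add: gram_det_eq_det[symmetric] M_def gram_det_def[of A S] sum_distrib_right)
qed

text \<open>Double counting: pairs (S, j) with j outside S match pairs (T, j) with j in T through T
  = \<open>insert j S\<close>, so each set of size k + 1 is counted k + 1 times.\<close>

lemma sum_gram_det_Er:
  fixes A :: "real^'n^'m"
  shows "(\<Sum>S | card S = k. gram_det A S * Er A S) = real (k + 1) * (\<Sum>S | card S = k + 1. gram_det A S)"
proof -
  have "(\<Sum>S | card S = k. gram_det A S * Er A S) =
      (\<Sum>S | card S = k. \<Sum>j\<in>-S. gram_det A (insert j S))"
    by (simp add: Er_eq_sum_col_residual sum_distrib_left gram_det_insert)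
  also have "\<dots> = (\<Sum>(S, j)\<in>(SIGMA S:{S. card S = k}. -S). gram_det A (insert j S))"
    by (rule sum.Sigma) auto
  also have "\<dots> = (\<Sum>(T, j)\<in>(SIGMA T:{T. card T = k + 1}. T). gram_det A T)"
    by (rule sum.reindex_bij_witness
        [where i = "\<lambda>(T, j). (T - {j}, j)" and j = "\<lambda>(S, j). (insert j S, j)"])
      (auto simp: insert_absorb card_Diff_singleton)
  also have "\<dots> = (\<Sum>T | card T = k + 1. \<Sum>j\<in>T. gram_det A T)"
    by (rule sum.Sigma[symmetric]) auto
  also have "\<dots> = (\<Sum>T | card T = k + 1. real (k + 1) * gram_det A T)"
    by (rule sum.cong) auto
  finally show ?thesis by (simp only: sum_distrib_left)
qed

section \<open>Gram determinants as coefficients of det(I + z A^T A)\<close>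

lemma gram_matrix_nth: "(transpose A ** A) $ i $ j = inner (column i A) (column j A)"
  for A :: "real^'n^'m"
  by (simp add: matrix_matrix_mult_def transpose_def column_def inner_vec_def)

text \<open>Multiplying out each Leibniz product selects a set \<open>S\<close> of rows that take
  their Gram entry; all other rows force \<open>p i = i\<close>, so only permutations of
  \<open>S\<close> survive.\<close>

lemma det_mat_plus_gram:
  fixes A :: "real^'n^'m"
  shows "det (mat 1 + z *\<^sub>R (transpose A ** A)) = (\<Sum>S\<in>UNIV. z ^ card S * gram_det A S)"
proof -
  let ?g = "\<lambda>i j. inner (column i A) (column j A)"
  have "det (mat 1 + z *\<^sub>R (transpose A ** A)) =
      (\<Sum>p | p permutes (UNIV :: 'n set). of_int (sign p) *
        (\<Prod>i\<in>UNIV. z * ?g i (p i) + of_bool (i = p i)))"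
    by (simp add: det_def gram_matrix_nth mat_def of_bool_def add.commute)
  also have "\<dots> = (\<Sum>p | p permutes (UNIV :: 'n set). \<Sum>S\<in>UNIV. of_int (sign p) *
        ((\<Prod>i\<in>S. z * ?g i (p i)) * (\<Prod>i\<in>-S. of_bool (i = p i))))"
    by (simp add: prod_add sum_distrib_left Compl_eq_Diff_UNIV)
  also have "\<dots> = (\<Sum>S\<in>UNIV. \<Sum>p | p permutes (UNIV :: 'n set). of_int (sign p) *
        ((\<Prod>i\<in>S. z * ?g i (p i)) * (\<Prod>i\<in>-S. of_bool (i = p i))))"
    by (rule sum.swap)
  also have "\<dots> = (\<Sum>S\<in>UNIV. z ^ card S * gram_det A S)"
  proof (rule sum.cong, rule refl)
    fix S :: "'n set"
    have "(\<Sum>p | p permutes (UNIV :: 'n set). of_int (sign p) *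
        ((\<Prod>i\<in>S. z * ?g i (p i)) * (\<Prod>i\<in>-S. of_bool (i = p i)))) =
      (\<Sum>p | p permutes S. of_int (sign p) *
        ((\<Prod>i\<in>S. z * ?g i (p i)) * (\<Prod>i\<in>-S. of_bool (i = p i))))"
    proof (rule sum_permutes_subset)
      fix p :: "'n \<Rightarrow> 'n" and i
      assume "i \<in> UNIV - S" "p i \<noteq> i"
      then have "(\<Prod>i\<in>-S. of_bool (i = p i) :: real) = 0" by (intro prod_zero) force+
      then show "of_int (sign p) *
        ((\<Prod>i\<in>S. z * ?g i (p i)) * (\<Prod>i\<in>-S. of_bool (i = p i))) = 0" by simp
    qed auto
    also have "\<dots> = (\<Sum>p | p permutes S. z ^ card S * (of_int (sign p) * (\<Prod>i\<in>S. ?g i (p i))))"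
      by (rule sum.cong) (auto simp: prod.distrib permutes_not_in)
    finally show "(\<Sum>p | p permutes (UNIV :: 'n set). of_int (sign p) *
        ((\<Prod>i\<in>S. z * ?g i (p i)) * (\<Prod>i\<in>-S. of_bool (i = p i)))) = z ^ card S * gram_det A S"
      by (simp add: gram_det_def sum_distrib_left)
  qed
  finally show ?thesis .
qed

subsection \<open>Elementary symmetric polynomials of the eigenvalues\<close>

text \<open>The generating polynomial of the elementary symmetric polynomials: its coefficient at j
  is e_j of \<open>lam 0\<close>, ..., \<open>lam (n - 1)\<close>.\<close>

definition esym_poly :: "(nat \<Rightarrow> real) \<Rightarrow> nat \<Rightarrow> real poly" where
  "esym_poly lam n = (\<Prod>i<n. [:1, lam i:])"

text \<open>Factoring \<open>-z\<close> out of every row leaves the characteristic matrix at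
  \<open>-1/z\<close>.\<close>

lemma det_mat_plus_gram_eigs:
  fixes A :: "real^'n^'m"
  assumes "sorted_eigs A lam" and z: "z \<noteq> 0"
  shows "det (mat 1 + z *\<^sub>R (transpose A ** A)) = poly (esym_poly lam CARD('n)) z"
proof -
  let ?G = "transpose A ** A"
  have "mat 1 + z *\<^sub>R ?G = (\<chi> i. (-z) *s (((-1/z) *\<^sub>R mat 1 - ?G) $ i))"
    using z by (simp add: vec_eq_iff algebra_simps)
  then have "det (mat 1 + z *\<^sub>R ?G) = (-z) ^ CARD('n) * det ((-1/z) *\<^sub>R mat 1 - ?G)"
    by (simp only: det_rows_mul vec_lambda_eta) simp
  also have "\<dots> = (-z) ^ CARD('n) * (\<Prod>i<CARD('n). -1/z - lam i)"
    using assms(1) by (simp only: sorted_eigs_def)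
  also have "\<dots> = (\<Prod>i<CARD('n). (-z) * (-1/z - lam i))"
    by (subst prod.distrib) simp
  also have "\<dots> = (\<Prod>i<CARD('n). 1 + z * lam i)"
    using z by (intro prod.cong) (auto simp: field_simps)
  finally show ?thesis by (simp add: esym_poly_def poly_prod)
qed

text \<open>The two evaluations of det(I + z A^T A) agree at infinitely many z, so their
  coefficients coincide.\<close>

lemma sum_gram_det_eq_coeff:
  fixes A :: "real^'n^'m"
  assumes "sorted_eigs A lam"
  shows "(\<Sum>S | card S = k. gram_det A S) = coeff (esym_poly lam CARD('n)) k"
proof -
  define q where "q = (\<Sum>S\<in>UNIV. monom (gram_det A S) (card S))"
  have "poly q z = poly (esym_poly lam CARD('n)) z" if "z \<noteq> 0" for z
    using det_mat_plus_gram[of z A] det_mat_plus_gram_eigs[OF assms that]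
    by (simp add: q_def poly_sum poly_monom mult.commute)
  then have "- {0} \<subseteq> {z. poly (q - esym_poly lam CARD('n)) z = 0}" by auto
  moreover have "infinite (- {0 :: real})"
    using infinite_UNIV_char_0 by (simp add: Compl_eq_Diff_UNIV)
  ultimately have "q - esym_poly lam CARD('n) = 0"
    using poly_roots_finite finite_subset by blast
  then have "coeff (esym_poly lam CARD('n)) k = coeff q k" by simp
  also have "\<dots> = (\<Sum>S | card S = k. gram_det A S)"
    by (simp add: q_def coeff_sum sum.If_cases)
  finally show ?thesis ..
qed

text \<open>An eigenvector v satisfies \<open>lam i\<close> |v|^2 = |A v|^2.\<close>

lemma sorted_eigs_nonneg:
  fixes A :: "real^'n^'m"
  assumes "sorted_eigs A lam" "i < CARD('n)"
  shows "0 \<le> lam i"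
proof -
  let ?G = "transpose A ** A"
  have "det (lam i *\<^sub>R mat 1 - ?G) = 0"
    using assms unfolding sorted_eigs_def by (auto intro: prod_zero)
  then obtain v where v: "v \<noteq> 0" "(lam i *\<^sub>R mat 1 - ?G) *v v = 0"
    by (metis det_eq_0_rank full_rank_injective less_irrefl matrix_left_invertible_ker
        matrix_left_invertible_injective)
  then have "lam i *\<^sub>R v = ?G *v v"
    by (simp add: matrix_vector_mult_diff_rdistrib scaleR_matrix_vector_assoc[symmetric])
  then have "lam i * inner v v = inner (A *v v) (A *v v)"
    by (metis dot_lmul_matrix inner_scaleR_left inner_commute matrix_vector_mul_assoc
        vector_transpose_matrix transpose_matrix_vector)
  then show ?thesis
    using v(1) by (metis inner_ge_zero inner_gt_zero_iff mult_neg_pos not_less)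
qed

section \<open>Recursion in the number of eigenvalues and monotonicity of the ratios\<close>

lemma esym_poly_Suc: "esym_poly lam (Suc n) = [:1, lam n:] * esym_poly lam n"
  by (simp add: esym_poly_def mult.commute)

lemma coeff_linear_mult_0: "coeff ([:1, x:] * p) 0 = coeff p 0"
  and coeff_linear_mult_Suc: "coeff ([:1, x:] * p) (Suc k) = coeff p (Suc k) + x * coeff p k"
  for x :: real
  by simp_all

lemma coeff_esym_poly_nonneg:
  assumes "\<And>i. i < n \<Longrightarrow> 0 \<le> lam i"
  shows "0 \<le> coeff (esym_poly lam n) k"
  using assms
proof (induction n arbitrary: k)
  case 0
  then show ?case by (cases k) (simp_all add: esym_poly_def)
next
  case (Suc n)
  then show ?case unfolding esym_poly_Suc
    by (cases k) (simp_all only: coeff_linear_mult_0 coeff_linear_mult_Suc, auto)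
qed

text \<open>A weak form of Newton's inequalities, cross-multiplied so that it survives vanishing
  coefficients: \<open>(k + 1) e\<^sub>k\<^sub>+\<^sub>1 / e\<^sub>k\<close> decreases in \<open>k\<close>.\<close>

lemma esym_newton:
  assumes "\<And>i. i < n \<Longrightarrow> 0 \<le> lam i" and "j \<le> k"
  shows "real (Suc k) * coeff (esym_poly lam n) (Suc k) * coeff (esym_poly lam n) j
       \<le> real (Suc j) * coeff (esym_poly lam n) (Suc j) * coeff (esym_poly lam n) k"
  using assms
proof (induction n arbitrary: j k)
  case 0
  then show ?case by (simp add: esym_poly_def)
next
  case (Suc n)
  define e where "e = coeff (esym_poly lam n)"
  define x where "x = lam n"
  have x: "0 \<le> x" and e: "0 \<le> e m" for m
    using Suc.prems coeff_esym_poly_nonneg[of n lam m] by (auto simp: x_def e_def)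
  have IH: "real (Suc k) * e (Suc k) * e j \<le> real (Suc j) * e (Suc j) * e k" if "j \<le> k" for j k
    unfolding e_def using Suc that by auto
  have e0: "coeff (esym_poly lam (Suc n)) 0 = e 0"
    and eS: "coeff (esym_poly lam (Suc n)) (Suc m) = e (Suc m) + x * e m" for m
    unfolding esym_poly_Suc x_def e_def by (simp_all only: coeff_linear_mult_0 coeff_linear_mult_Suc)
  show ?case
  proof (cases k)
    case 0
    with Suc.prems show ?thesis by simp
  next
    case k: (Suc k')
    show ?thesis
    proof (cases j)
      case 0
      have "real (Suc k) * e (Suc k) * e 0 \<le> e 1 * e k"
        using IH[of 0 k] by simp
      moreover have "x * (real k * e k * e 0) \<le> x * (e 1 * e k')"
        using IH[of 0 k'] x k by (intro mult_left_mono) auto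
      moreover have "0 \<le> x * e 0 * (x * e k')" using x e by simp
      ultimately show ?thesis
        unfolding 0 k e0 eS by (simp add: k algebra_simps)
    next
      case j: (Suc j')
      have jk: "j' \<le> k'" using Suc.prems j k by simp
      \<comment> \<open>Both sides are quadratic in the new eigenvalue \<open>x\<close>;
        \<open>c0\<close>, \<open>c1\<close> and \<open>c2\<close> compare the coefficients of 1, x
        and x^2.\<close>
      have c0: "real (Suc k) * e (Suc k) * e j \<le> real (Suc j) * e (Suc j) * e k"
        using IH Suc.prems by blast
      \<comment> \<open>The hypothesis at (j', k') has factors k and j. Raising both by one costs
        \<open>e k * e j' \<le> e j * e k'\<close>, which follows from the same hypothesis as j <=
        k.\<close>
      have c2: "real (Suc k) * e k * e j' \<le> real (Suc j) * e j * e k'"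
      proof -
        have a: "real k * e k * e j' \<le> real j * e j * e k'"
          using IH[OF jk] by (simp add: j k)
        also have "\<dots> \<le> real k * e j * e k'"
          using Suc.prems e by (intro mult_right_mono) auto
        finally have "real k * (e k * e j') \<le> real k * (e j * e k')" by (simp add: mult.assoc)
        then have "e k * e j' \<le> e j * e k'" by (simp add: k)
        with a show ?thesis by (simp add: algebra_simps)
      qed
      \<comment> \<open>For j = k both sides coincide. Otherwise the hypotheses at (j, k') and (j',
        k) add up to the claim with one copy of \<open>e j * e k\<close> missing on each
        side.\<close>
      have c1: "real (Suc k) * (e (Suc k) * e j' + e k * e j) \<le> real (Suc j) * (e (Suc j) * e k' + e j * e k)"
      proof (cases "j = k")
        case True
        then show ?thesis using j k by simp
      next
        case False
        then have "j \<le> k'" using Suc.prems k by simp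
        from IH[OF this] have "real k * e k * e j \<le> real (Suc j) * e (Suc j) * e k'"
          by (simp add: k)
        moreover have "real (Suc k) * e (Suc k) * e j' \<le> real j * e j * e k"
          using IH[of j' k] jk j k by simp
        ultimately show ?thesis by (simp add: algebra_simps)
      qed
      have "real (Suc k) * e (Suc k) * e j + x * (real (Suc k) * (e (Suc k) * e j' + e k * e j))
          + x\<^sup>2 * (real (Suc k) * e k * e j')
        \<le> real (Suc j) * e (Suc j) * e k + x * (real (Suc j) * (e (Suc j) * e k' + e j * e k))
          + x\<^sup>2 * (real (Suc j) * e j * e k')"
        using x by (intro add_mono mult_left_mono c0 c1 c2) auto
      then show ?thesis
        unfolding j k eS by (simp add: j k algebra_simps power2_eq_square)
    qed
  qed
qed

subsection \<open>Tail bounds\<close>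

text \<open>Markov's inequality for z^N: a term with j > k grows by the factor z^j / z^(k+1) >=
  1.\<close>

lemma poly_le_partial_sum_plus_tail:
  fixes p :: "real poly"
  assumes c: "\<And>j. 0 \<le> coeff p j" and y: "0 \<le> y" and z: "1 \<le> z"
  shows "poly p y \<le> (\<Sum>j\<le>k. coeff p j * y ^ j) + poly p (z * y) / z ^ Suc k"
proof -
  let ?D = "degree p"
  have "poly p y = (\<Sum>j\<le>?D. coeff p j * y ^ j)" by (rule poly_altdef)
  also have "\<dots> \<le> (\<Sum>j\<le>?D. (if j \<le> k then coeff p j * y ^ j else 0)
      + coeff p j * (z * y) ^ j / z ^ Suc k)"
  proof (rule sum_mono)
    fix j
    show "coeff p j * y ^ j \<le> (if j \<le> k then coeff p j * y ^ j else 0)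
      + coeff p j * (z * y) ^ j / z ^ Suc k"
    proof (cases "j \<le> k")
      case True
      then show ?thesis using c y z by simp
    next
      case False
      then have "z ^ Suc k \<le> z ^ j" using z by (intro power_increasing) auto
      then have "1 \<le> z ^ j / z ^ Suc k" using z by (simp add: le_divide_eq del: power_Suc)
      then have "coeff p j * y ^ j * 1 \<le> coeff p j * y ^ j * (z ^ j / z ^ Suc k)"
        using c y by (intro mult_left_mono) auto
      then show ?thesis using False by (simp add: power_mult_distrib mult_ac)
    qed
  qed
  also have "\<dots> = (\<Sum>j\<in>{..?D} \<inter> {..k}. coeff p j * y ^ j) + poly p (z * y) / z ^ Suc k"
    by (simp add: sum.distrib sum.If_cases poly_altdef[of p "z * y"] sum_divide_distrib Collect_conv_if atMost_def del: power_Suc)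
  also have "(\<Sum>j\<in>{..?D} \<inter> {..k}. coeff p j * y ^ j) \<le> (\<Sum>j\<le>k. coeff p j * y ^ j)"
    using c y by (intro sum_mono2) auto
  finally show ?thesis by simp
qed

lemma partial_sum_le_poly:
  fixes p :: "real poly"
  assumes c: "\<And>j. 0 \<le> coeff p j" and y: "0 \<le> y"
  shows "(\<Sum>j\<le>k. coeff p j * y ^ j) \<le> poly p y"
proof -
  have "(\<Sum>j\<le>k. coeff p j * y ^ j) \<le> (\<Sum>j\<le>max k (degree p). coeff p j * y ^ j)"
    using c y by (intro sum_mono2) auto
  also have "\<dots> = poly p y"
    unfolding poly_altdef by (intro sum.mono_neutral_right) (auto simp: coeff_eq_0)
  finally show ?thesis .
qed

text \<open>Logarithmic derivative of the product; multiplied by y / p(y) it is the mean of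
  N.\<close>

lemma poly_pderiv_esym_poly:
  assumes "\<And>i. i < n \<Longrightarrow> 1 + y * lam i \<noteq> 0"
  shows "poly (pderiv (esym_poly lam n)) y = poly (esym_poly lam n) y * (\<Sum>i<n. lam i / (1 + y * lam i))"
proof -
  have "poly (pderiv (esym_poly lam n)) y = (\<Sum>i<n. (\<Prod>j\<in>{..<n}-{i}. 1 + y * lam j) * lam i)"
    by (simp add: esym_poly_def pderiv_prod poly_sum poly_prod pderiv_pCons mult.commute)
  also have "\<dots> = (\<Sum>i<n. poly (esym_poly lam n) y * (lam i / (1 + y * lam i)))"
  proof (rule sum.cong, rule refl)
    fix i assume i: "i \<in> {..<n}"
    have "poly (esym_poly lam n) y = (\<Prod>j<n. 1 + y * lam j)"
      by (simp add: esym_poly_def poly_prod)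
    also have "\<dots> = (1 + y * lam i) * (\<Prod>j\<in>{..<n}-{i}. 1 + y * lam j)"
      using i by (intro prod.remove) auto
    finally have "poly (esym_poly lam n) y = (1 + y * lam i) * (\<Prod>j\<in>{..<n}-{i}. 1 + y * lam j)" .
    then show "(\<Prod>j\<in>{..<n}-{i}. 1 + y * lam j) * lam i = poly (esym_poly lam n) y * (lam i / (1 + y * lam i))"
      using assms[of i] i by simp
  qed
  finally show ?thesis by (simp add: sum_distrib_left)
qed

text \<open>In probabilistic terms \<open>e\<^sub>j y\<^sup>j\<close> are the weights of a Poisson binomial variable \<open>N\<close> with success
  probabilities \<open>y \<lambda>\<^sub>i / (1 + y \<lambda>\<^sub>i)\<close>. Averaging \<open>(j + 1) e\<^sub>j\<^sub>+\<^sub>1 y / e\<^sub>j\<close> over its law gives the mean of \<open>N\<close>, and by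
  monotonicity of this ratio the average is at least its value at \<open>k\<close> times \<open>P(N \<le> k)\<close>.\<close>

lemma esym_ratio_bound:
  fixes lam :: "nat \<Rightarrow> real" and n :: nat
  defines "p \<equiv> esym_poly lam n"
  assumes lam: "\<And>i. i < n \<Longrightarrow> 0 \<le> lam i" and y: "0 < y" and z: "1 \<le> z"
    and mean: "(\<Sum>i<n. y * lam i / (1 + y * lam i)) \<le> real k"
    and tail: "poly p (z * y) / z ^ Suc k \<le> \<delta> * poly p y"
  shows "real (Suc k) * coeff p (Suc k) * (1 - \<delta>) * y \<le> real k * coeff p k"
proof -
  define h where "h = (\<Sum>j\<le>k. coeff p j * y ^ j)"
  have c: "0 \<le> coeff p j" for j
    unfolding p_def by (rule coeff_esym_poly_nonneg[OF lam])
  have pos: "0 < 1 + y * lam i" if "i < n" for i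
    using mult_nonneg_nonneg[of y "lam i"] lam[OF that] y by linarith
  have Z: "0 < poly p y"
    unfolding p_def esym_poly_def poly_prod using pos by (intro prod_pos) auto
  \<comment> \<open>This is P(N <= k) >= 1 - \<delta>, with \<open>h\<close> the unnormalised
    probability.\<close>
  have h: "(1 - \<delta>) * poly p y \<le> h"
    using poly_le_partial_sum_plus_tail[of p y z k] c y z tail by (simp add: h_def algebra_simps)
  have "real (Suc k) * coeff p (Suc k) * ((1 - \<delta>) * poly p y) \<le> real (Suc k) * coeff p (Suc k) * h"
    using h c by (intro mult_left_mono) auto
  also have "\<dots> = (\<Sum>j\<le>k. real (Suc k) * coeff p (Suc k) * coeff p j * y ^ j)"
    by (simp add: h_def sum_distrib_left mult.assoc)
  \<comment> \<open>Newton's inequality moves the shift from k to j, producing the coefficients of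
    the derivative.\<close>
  also have "\<dots> \<le> (\<Sum>j\<le>k. real (Suc j) * coeff p (Suc j) * coeff p k * y ^ j)"
    unfolding p_def using y by (intro sum_mono mult_right_mono esym_newton[OF lam]) auto
  also have "\<dots> = coeff p k * (\<Sum>j\<le>k. coeff (pderiv p) j * y ^ j)"
    by (simp add: coeff_pderiv sum_distrib_left mult_ac)
  also have "\<dots> \<le> coeff p k * poly (pderiv p) y"
    using c y by (intro mult_left_mono partial_sum_le_poly) (auto simp: coeff_pderiv)
  finally have "y * (real (Suc k) * coeff p (Suc k) * ((1 - \<delta>) * poly p y))
      \<le> y * (coeff p k * poly (pderiv p) y)"
    using y by simp
  also have "\<dots> = coeff p k * poly p y * (\<Sum>i<n. y * lam i / (1 + y * lam i))"
    using poly_pderiv_esym_poly[of n y lam] pos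
    by (simp add: p_def sum_distrib_left less_imp_neq[symmetric] mult_ac)
  also have "\<dots> \<le> coeff p k * poly p y * real k"
    using c Z mean by (intro mult_left_mono) auto
  finally have "poly p y * (real (Suc k) * coeff p (Suc k) * (1 - \<delta>) * y) \<le> poly p y * (real k * coeff p k)"
    by (simp add: mult_ac)
  then show ?thesis using Z by (simp only: mult_le_cancel_left_pos)
qed

text \<open>A Chernoff bound, with \<open>z\<close> factored out of each of the first \<open>k\<close> trials.\<close>

lemma esym_poly_chernoff:
  assumes lam: "\<And>i. i < n \<Longrightarrow> 0 \<le> lam i" and y: "0 \<le> y" and z: "1 \<le> z" and kn: "k \<le> n"
  shows "poly (esym_poly lam n) (z * y) \<le> z ^ k *
    exp ((z - 1) * (\<Sum>i=k..<n. y * lam i / (1 + y * lam i)) - (1 - 1/z) * (\<Sum>i<k. 1 / (1 + y * lam i)))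
    * poly (esym_poly lam n) y"
proof -
  let ?f = "\<lambda>i. 1 + z * y * lam i" and ?g = "\<lambda>i. 1 + y * lam i"
  have pos: "0 < ?g i" "0 \<le> ?f i" if "i < n" for i
    using lam[OF that] y z by (auto intro!: add_pos_nonneg add_nonneg_nonneg)
  have split: "(\<Prod>i<n. f i) = (\<Prod>i<k. f i) * (\<Prod>i=k..<n. f i)" for f :: "nat \<Rightarrow> real"
    using prod.atLeastLessThan_concat[of 0 k n f] kn by (simp add: atLeast0LessThan)
  have a: "(\<Prod>i<k. ?f i) \<le> (\<Prod>i<k. z * exp (- ((1 - 1/z) * (1 / ?g i))) * ?g i)"
  proof (rule prod_mono, safe)
    fix i assume i: "i < k"
    with kn have g: "0 < ?g i" and f: "0 \<le> ?f i" using pos[of i] by auto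
    \<comment> \<open>With \<open>x = 1 + y * lam i\<close>, 1/x is the failure probability of trial
      i. The extracted factors z form z^k, which later cancels all but one factor of
      z^(k+1).\<close>
    have "z * (1 - (1 - 1/z) * (1 / x)) * x = z * x - (z - 1)" if "0 < x" for x
      using that z by (simp add: field_simps)
    from this[OF g] have "?f i = z * (1 - (1 - 1/z) * (1 / ?g i)) * ?g i"
      by (simp add: algebra_simps)
    also have "\<dots> \<le> z * exp (- ((1 - 1/z) * (1 / ?g i))) * ?g i"
      using g z exp_ge_add_one_self[of "- ((1 - 1/z) * (1 / ?g i))"]
      by (intro mult_right_mono mult_left_mono) auto
    finally show "?f i \<le> z * exp (- ((1 - 1/z) * (1 / ?g i))) * ?g i" .
    show "0 \<le> ?f i" by fact
  qed
  have b: "(\<Prod>i=k..<n. ?f i) \<le> (\<Prod>i=k..<n. exp ((z - 1) * (y * lam i / ?g i)) * ?g i)"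
  proof (rule prod_mono, safe)
    fix i assume i: "i \<in> {k..<n}"
    then have g: "0 < ?g i" and f: "0 \<le> ?f i" using pos[of i] by auto
    have "?f i = (1 + (z - 1) * (y * lam i / ?g i)) * ?g i"
      using g by (simp add: field_simps)
    also have "\<dots> \<le> exp ((z - 1) * (y * lam i / ?g i)) * ?g i"
      using g by (intro mult_right_mono exp_ge_add_one_self) auto
    finally show "?f i \<le> exp ((z - 1) * (y * lam i / ?g i)) * ?g i" .
    show "0 \<le> ?f i" by fact
  qed
  have "poly (esym_poly lam n) (z * y) = (\<Prod>i<k. ?f i) * (\<Prod>i=k..<n. ?f i)"
    by (simp add: esym_poly_def poly_prod split)
  also have "\<dots> \<le> (\<Prod>i<k. z * exp (- ((1 - 1/z) * (1 / ?g i))) * ?g i) *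
      (\<Prod>i=k..<n. exp ((z - 1) * (y * lam i / ?g i)) * ?g i)"
    using pos kn z by (intro mult_mono a b prod_nonneg) (auto simp: less_imp_le)
  also have "\<dots> = z ^ k * (exp (\<Sum>i<k. - ((1 - 1/z) * (1 / ?g i))) *
      exp (\<Sum>i=k..<n. (z - 1) * (y * lam i / ?g i))) * ((\<Prod>i<k. ?g i) * (\<Prod>i=k..<n. ?g i))"
    by (simp only: prod.distrib exp_sum finite_lessThan finite_atLeastLessThan prod_constant card_lessThan mult_ac)
  also have "exp (\<Sum>i<k. - ((1 - 1/z) * (1 / ?g i))) *
      exp (\<Sum>i=k..<n. (z - 1) * (y * lam i / ?g i)) =
     exp ((z - 1) * (\<Sum>i=k..<n. y * lam i / ?g i) - (1 - 1/z) * (\<Sum>i<k. 1 / ?g i))"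
    by (simp only: sum_negf sum_distrib_left exp_add[symmetric]) simp
  also have "(\<Prod>i<k. ?g i) * (\<Prod>i=k..<n. ?g i) = poly (esym_poly lam n) y"
    by (simp add: esym_poly_def poly_prod split)
  finally show ?thesis .
qed

subsection \<open>The approximation factor\<close>

text \<open>The right-hand sides bound from below the expected number of failures among the leading
  trials. The first claim makes these outweigh the expected successes among the others, the second
  makes them numerous enough for the Chernoff bound. Both rest on \<gamma>^2 \<tau> = \<tau> + 2
  \<kappa>.\<close>

lemma deficit_lower_bounds:
  fixes \<kappa> \<tau> w :: real
  defines "\<gamma> \<equiv> sqrt (1 + 2 * \<kappa> / \<tau>)"
  assumes \<tau>: "1 \<le> \<tau>" and w: "8 / 3 \<le> w" and \<kappa>: "7 * w\<^sup>2 \<le> \<kappa>"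
  shows "\<kappa> / \<gamma> \<le> \<kappa> / (1 + \<kappa> / (\<gamma> * \<tau>))" and "3 * w \<le> \<kappa> / (1 + \<kappa> / (\<gamma> * \<tau>))"
proof -
  have "0 < w\<^sup>2" using w by simp
  with \<kappa> have \<kappa>0: "0 < \<kappa>" by linarith
  have \<gamma>2: "\<gamma>\<^sup>2 = 1 + 2 * \<kappa> / \<tau>" and \<gamma>: "0 < \<gamma>"
    unfolding \<gamma>_def using \<kappa>0 \<tau> by (auto simp: add_pos_nonneg)
  have sq: "(\<gamma> * \<tau>)\<^sup>2 = \<tau>\<^sup>2 + 2 * \<kappa> * \<tau>"
    using \<tau> unfolding power_mult_distrib \<gamma>2 by (simp add: field_simps power2_eq_square)
  have "\<gamma> * \<tau> \<le> \<tau> + \<kappa>"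
    by (rule power2_le_imp_le) (use \<tau> \<kappa>0 in \<open>auto simp: sq power2_sum\<close>)
  also have "\<dots> = \<gamma> * (\<gamma> * \<tau>) - \<kappa>"
  proof -
    have "\<gamma> * (\<gamma> * \<tau>) = \<gamma>\<^sup>2 * \<tau>" by (simp add: power2_eq_square)
    also have "\<dots> = \<tau> + 2 * \<kappa>" using \<tau> unfolding \<gamma>2 by (simp add: field_simps)
    finally show ?thesis by simp
  qed
  finally have "1 + \<kappa> / (\<gamma> * \<tau>) \<le> \<gamma>"
    using \<gamma> \<tau> by (simp add: field_simps)
  then show "\<kappa> / \<gamma> \<le> \<kappa> / (1 + \<kappa> / (\<gamma> * \<tau>))"
    using \<kappa>0 \<gamma> \<tau> by (intro divide_left_mono) (auto simp: add_pos_pos)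
  define r where "r = sqrt (2 * \<kappa>)"
  have r2: "r\<^sup>2 = 2 * \<kappa>" and r: "0 < r" using \<kappa>0 by (auto simp: r_def)
  \<comment> \<open>As \<tau> >= 1, \<open>(\<gamma> * \<tau>)\<^sup>2\<close> is at least 2
    \<kappa>, which eliminates \<tau> from the bound.\<close>
  have "r \<le> \<gamma> * \<tau>"
  proof (rule power2_le_imp_le)
    have "2 * \<kappa> * 1 \<le> 2 * \<kappa> * \<tau>" using \<tau> \<kappa>0 by (intro mult_left_mono) auto
    then show "r\<^sup>2 \<le> (\<gamma> * \<tau>)\<^sup>2" unfolding sq r2 by (smt (verit) zero_le_power2)
  qed (use \<gamma> \<tau> in auto)
  then have "\<kappa> / (1 + \<kappa> / r) \<le> \<kappa> / (1 + \<kappa> / (\<gamma> * \<tau>))"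
    using \<kappa>0 \<gamma> \<tau> r by (intro divide_left_mono add_left_mono) (auto simp: add_pos_pos)
  moreover have "3 * w \<le> \<kappa> / (1 + \<kappa> / r)"
  proof -
    \<comment> \<open>3.74 lies just below the square root of 14, and r^2 = 2 \<kappa> >= 14 w^2.
      Below, 0.74 is 3.74 - 3, and w >= 8/3 gives 3.74 * 0.74 * w >= 6.\<close>
    have rw: "3.74 * w \<le> r"
    proof (rule power2_le_imp_le)
      have "(3.74 * w)\<^sup>2 \<le> 14 * w\<^sup>2" by (simp add: power_mult_distrib power2_eq_square)
      then show "(3.74 * w)\<^sup>2 \<le> r\<^sup>2" using \<kappa> r2 by linarith
    qed (use r in auto)
    have "6 * w \<le> (3.74 * w) * (0.74 * w)"
      using w mult_right_mono[of "8/3" w w] by (simp add: power2_eq_square)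
    also have "\<dots> \<le> r * (r - 3 * w)"
      using rw w by (intro mult_mono) auto
    finally have *: "3 * w * (2 + r) \<le> r\<^sup>2" by (simp add: algebra_simps power2_eq_square)
    have "\<kappa> / (1 + \<kappa> / r) = r\<^sup>2 / (2 + r)"
    proof -
      have "\<kappa> = r\<^sup>2 / 2" using r2 by simp
      then have "1 + \<kappa> / r = (2 + r) / 2" using r by (simp add: field_simps power2_eq_square)
      then have "\<kappa> / (1 + \<kappa> / r) = \<kappa> / ((2 + r) / 2)" by (simp only:)
      then show ?thesis by (simp add: r2)
    qed
    moreover have "3 * w \<le> r\<^sup>2 / (2 + r)"
      using * r by (subst pos_le_divide_eq) auto
    ultimately show ?thesis by linarith
  qed
  ultimately show "3 * w \<le> \<kappa> / (1 + \<kappa> / (\<gamma> * \<tau>))" by linarith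
qed

text \<open>For \<open>u\<close> the expected number of failures among the \<open>k\<close> leading trials and \<open>l\<close> the expected
  number of successes among the others, this bounds the tail from \<open>esym_poly_chernoff\<close> at \<open>z = 1 + \<epsilon>\<close>.\<close>

lemma chernoff_exponent_bound:
  fixes \<epsilon> u l :: real
  assumes eps: "0 < \<epsilon>" "\<epsilon> \<le> 1/2" and u: "3 * (ln (1/\<epsilon>) / \<epsilon>\<^sup>2) \<le> u" and l: "l \<le> u / (1 + 2*\<epsilon>)"
  shows "exp (\<epsilon> * l - (1 - 1/(1+\<epsilon>)) * u) / (1 + \<epsilon>) \<le> 2*\<epsilon> / (1 + 2*\<epsilon>)"
proof -
  have ln: "0 \<le> ln (1/\<epsilon>)" using eps by simp
  have u0: "0 \<le> u" using u ln eps by (smt (verit) divide_nonneg_nonneg zero_le_power2)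
  have "\<epsilon> * l - (1 - 1/(1+\<epsilon>)) * u \<le> \<epsilon> * (u / (1 + 2*\<epsilon>)) - (1 - 1/(1+\<epsilon>)) * u"
    using l eps by (intro diff_right_mono mult_left_mono) auto
  \<comment> \<open>The exponent is negative because the gap 1 + 2 \<epsilon> between u and l
    exceeds z = 1 + \<epsilon>.\<close>
  also have "\<dots> = - (\<epsilon>\<^sup>2 * u / ((1 + \<epsilon>) * (1 + 2*\<epsilon>)))"
    using eps by (simp add: divide_simps) (simp add: algebra_simps power2_eq_square)
  \<comment> \<open>The product is at most 3 for \<epsilon> <= 1/2, matching the 3 in the hypothesis
    on \<open>u\<close>.\<close>
  also have "\<dots> \<le> - (\<epsilon>\<^sup>2 * u / 3)"
  proof -
    have "(1 + \<epsilon>) * (1 + 2*\<epsilon>) \<le> (1 + 1/2) * (1 + 2*(1/2))"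
      using eps by (intro mult_mono) auto
    then show ?thesis using eps u0
      by (intro le_imp_neg_le divide_left_mono) (auto intro!: mult_pos_pos)
  qed
  also have "\<dots> \<le> ln \<epsilon>"
    using u eps by (simp add: ln_div field_simps)
  finally have "exp (\<epsilon> * l - (1 - 1/(1+\<epsilon>)) * u) \<le> exp (ln \<epsilon>)" by simp
  then have "exp (\<epsilon> * l - (1 - 1/(1+\<epsilon>)) * u) / (1 + \<epsilon>) \<le> \<epsilon> / (1 + \<epsilon>)"
    using eps by (intro divide_right_mono) auto
  also have "\<dots> \<le> 2*\<epsilon> / (1 + 2*\<epsilon>)" using eps by (simp add: field_simps)
  finally show ?thesis .
qed

text \<open>Instance of \<open>esym_ratio_bound\<close> with z = 1 + \<epsilon> and \<delta> = 2
  \<epsilon> / (1 + 2 \<epsilon>). The mean of N is k - U + L, so mean and tail are controlled once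
  L <= U / (1 + 2 \<epsilon>) and U is large. One factor 1 + 2 \<epsilon> comes from
  \<open>y\<close>, the other from 1 / (1 - \<delta>).\<close>

lemma esym_ratio_le_OPT:
  fixes lam :: "nat \<Rightarrow> real" and s k n :: nat and \<epsilon> :: real
  defines "c \<equiv> coeff (esym_poly lam n)"
    and "\<kappa> \<equiv> real k - real s" and "\<tau> \<equiv> real s + stable_rank lam n s - real k"
  assumes lam: "\<And>i. i < n \<Longrightarrow> 0 \<le> lam i"
    and dec: "\<And>i j. i \<le> j \<Longrightarrow> j < n \<Longrightarrow> lam j \<le> lam i"
    and eps: "0 < \<epsilon>" "\<epsilon> \<le> 1/2"
    and k_lo: "7 / \<epsilon>^4 * (ln (1/\<epsilon>))\<^sup>2 \<le> \<kappa>"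
    and \<tau>: "1 \<le> \<tau>"
  shows "0 < OPT lam n k"
    and "real (k + 1) * c (k + 1) \<le>
      (1 + 2*\<epsilon>)\<^sup>2 * ((1 + real s / \<kappa>) * sqrt (1 + 2 * \<kappa> / \<tau>)) * OPT lam n k * c k"
proof -
  \<comment> \<open>Scaled so that \<open>k_lo\<close> reads 7 w^2 <= \<kappa>. The 8/3 comes from
    ln 2 >= 2/3 and \<epsilon>^2 <= 1/4.\<close>
  define w where "w = ln (1/\<epsilon>) / \<epsilon>\<^sup>2"
  have w: "8/3 \<le> w"
  proof -
    have "ln 2 \<le> ln (1/\<epsilon>)" using eps by (subst ln_le_cancel_iff) (auto simp: field_simps)
    then have a: "2/3 \<le> ln (1/\<epsilon>)" using ln2_ge_two_thirds by linarith
    have "\<epsilon>\<^sup>2 \<le> (1/2)\<^sup>2" using eps by (intro power_mono) auto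
    then have "8/3 * \<epsilon>\<^sup>2 \<le> 2/3" by (simp add: power2_eq_square)
    with a have "8/3 * \<epsilon>\<^sup>2 \<le> ln (1/\<epsilon>)" by linarith
    then show ?thesis using eps by (simp add: w_def field_simps)
  qed
  have \<kappa>w: "7 * w\<^sup>2 \<le> \<kappa>"
    using k_lo by (simp add: w_def power_divide power_mult[symmetric])
  moreover have "0 < w\<^sup>2" using w by simp
  ultimately have \<kappa>: "0 < \<kappa>" by linarith
  then have sk: "s < k" by (simp add: \<kappa>_def)
  define \<sigma> where "\<sigma> = stable_rank lam n s"
  have \<sigma>: "\<kappa> + 1 \<le> \<sigma>" using \<tau> by (simp add: \<kappa>_def \<tau>_def \<sigma>_def)
  \<comment> \<open>An empty sum, or a division by \<open>lam s = 0\<close>, would make the stable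
    rank 0, yet it exceeds 1.\<close>
  have sn: "s < n"
    using \<sigma> \<kappa> by (rule_tac ccontr) (simp add: \<sigma>_def stable_rank_def)
  have ls: "0 < lam s"
    using \<sigma> \<kappa> lam[OF sn] by (cases "lam s = 0") (auto simp: \<sigma>_def stable_rank_def)
  have sum_s: "(\<Sum>i=s..<n. lam i) = \<sigma> * lam s"
    using ls by (simp add: \<sigma>_def stable_rank_def)
  have kn: "k < n"
  proof -
    have "\<sigma> * lam s \<le> (\<Sum>i=s..<n. lam s)"
      unfolding sum_s[symmetric] using dec by (intro sum_mono) auto
    also have "\<dots> = (real n - real s) * lam s" using sn by simp
    finally have "\<sigma> \<le> real n - real s" using ls by simp
    then show ?thesis using \<sigma> by (simp add: \<kappa>_def)
  qed
  \<comment> \<open>The k - s terms removed from the sum \<open>\<sigma> * lam s\<close> are at most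
    \<open>lam s\<close> each.\<close>
  have opt: "\<tau> * lam s \<le> OPT lam n k"
  proof -
    have "\<sigma> * lam s = (\<Sum>i=s..<k. lam i) + OPT lam n k"
      unfolding sum_s[symmetric] OPT_def using sk kn by (simp add: sum.atLeastLessThan_concat)
    moreover have "(\<Sum>i=s..<k. lam i) \<le> (\<Sum>i=s..<k. lam s)"
      using dec kn by (intro sum_mono) auto
    moreover have "(\<Sum>i=s..<k. lam s) = \<kappa> * lam s" using sk by (simp add: \<kappa>_def)
    ultimately show ?thesis by (simp add: \<tau>_def \<sigma>_def \<kappa>_def algebra_simps)
  qed
  show opt0: "0 < OPT lam n k"
    using opt ls \<tau> by (smt (verit) mult_pos_pos)

  define \<gamma> where "\<gamma> = sqrt (1 + 2 * \<kappa> / \<tau>)"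
  have \<gamma>: "0 < \<gamma>" unfolding \<gamma>_def using \<kappa> \<tau> by (auto simp: add_pos_nonneg)
  \<comment> \<open>This is 1/alpha, tuned so that \<open>y * OPT lam n k\<close> is \<kappa> /
    \<gamma> with a factor 1 + 2 \<epsilon> to spare.\<close>
  define y where "y = \<kappa> / ((1 + 2*\<epsilon>) * \<gamma> * OPT lam n k)"
  have y: "0 < y" using \<kappa> \<gamma> opt0 eps by (simp add: y_def)
  have pos: "0 < 1 + y * lam i" if "i < n" for i
    using mult_nonneg_nonneg[of y "lam i"] lam[OF that] y by linarith
  define U where "U = (\<Sum>i<k. 1 / (1 + y * lam i))"
  define L where "L = (\<Sum>i=k..<n. y * lam i / (1 + y * lam i))"
  \<comment> \<open>Only the trials from s to k - 1 are kept; there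
    \<open>lam i \<le> lam s\<close>, and \<open>opt\<close> controls
    \<open>y * lam s\<close>.\<close>
  have U: "\<kappa> / (1 + \<kappa> / (\<gamma> * \<tau>)) \<le> U"
  proof -
    have "y * lam s \<le> \<kappa> / (\<gamma> * \<tau>)"
    proof -
      have "\<gamma> * (\<tau> * lam s) \<le> (1 + 2*\<epsilon>) * \<gamma> * OPT lam n k"
        using opt opt0 \<gamma> eps ls \<tau> by (intro mult_mono) auto
      then have "y \<le> \<kappa> / (\<gamma> * (\<tau> * lam s))"
        unfolding y_def using \<kappa> \<gamma> \<tau> ls opt0 eps by (intro divide_left_mono) auto
      then have "y * lam s \<le> \<kappa> / (\<gamma> * (\<tau> * lam s)) * lam s"
        using ls by (intro mult_right_mono) auto
      then show ?thesis using ls by simp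
    qed
    then have "\<kappa> / (1 + \<kappa> / (\<gamma> * \<tau>)) \<le> \<kappa> / (1 + y * lam s)"
      using \<kappa> pos[OF sn] \<gamma> \<tau> by (intro divide_left_mono) (auto simp: add_pos_pos)
    also have "\<dots> = (\<Sum>i=s..<k. 1 / (1 + y * lam s))" using sk by (simp add: \<kappa>_def)
    also have "\<dots> \<le> (\<Sum>i=s..<k. 1 / (1 + y * lam i))"
      using dec kn y pos by (intro sum_mono divide_left_mono) auto
    also have "\<dots> \<le> U" unfolding U_def
      using pos kn by (intro sum_mono2) (auto simp: less_imp_le)
    finally show ?thesis .
  qed
  have L: "L \<le> U / (1 + 2*\<epsilon>)"
  proof -
    have "L \<le> (\<Sum>i=k..<n. y * lam i)" unfolding L_def
    proof (rule sum_mono)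
      fix i assume i: "i \<in> {k..<n}"
      then have "0 \<le> y * lam i" using y lam by simp
      then show "y * lam i / (1 + y * lam i) \<le> y * lam i"
        using divide_left_mono[of 1 "1 + y * lam i" "y * lam i"] by simp
    qed
    also have "\<dots> = y * OPT lam n k" by (simp add: OPT_def sum_distrib_left)
    also have "\<dots> = (\<kappa> / \<gamma>) / (1 + 2*\<epsilon>)" using opt0 by (simp add: y_def)
    also have "\<dots> \<le> U / (1 + 2*\<epsilon>)"
      using deficit_lower_bounds(1)[OF \<tau> w \<kappa>w] U eps unfolding \<gamma>_def by (intro divide_right_mono) auto
    finally show ?thesis .
  qed
  have Uw: "3 * w \<le> U" using deficit_lower_bounds(2)[OF \<tau> w \<kappa>w] U unfolding \<gamma>_def by linarith
  have "U / (1 + 2*\<epsilon>) \<le> U / 1"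
    using Uw w eps by (intro divide_left_mono) auto
  then have LU: "L \<le> U" using L by linarith
  have mean: "(\<Sum>i<n. y * lam i / (1 + y * lam i)) \<le> real k"
  proof -
    have "(\<Sum>i<n. y * lam i / (1 + y * lam i)) = (\<Sum>i<k. y * lam i / (1 + y * lam i)) + L"
      using sum.atLeastLessThan_concat[of 0 k n "\<lambda>i. y * lam i / (1 + y * lam i)"] kn
      by (simp add: L_def atLeast0LessThan)
    also have "(\<Sum>i<k. y * lam i / (1 + y * lam i)) = (\<Sum>i<k. 1 - 1 / (1 + y * lam i))"
    proof (rule sum.cong, rule refl)
      fix i assume "i \<in> {..<k}"
      then show "y * lam i / (1 + y * lam i) = 1 - 1 / (1 + y * lam i)"
        using pos[of i] kn by (simp add: field_simps)
    qed
    also have "\<dots> = real k - U" by (simp add: U_def sum_subtractf)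
    finally show ?thesis using LU by linarith
  qed
  have tail: "poly (esym_poly lam n) ((1 + \<epsilon>) * y) / (1 + \<epsilon>) ^ Suc k
      \<le> 2*\<epsilon> / (1 + 2*\<epsilon>) * poly (esym_poly lam n) y"
  proof -
    let ?E = "exp (\<epsilon> * L - (1 - 1/(1+\<epsilon>)) * U)"
    have "poly (esym_poly lam n) ((1 + \<epsilon>) * y) \<le> (1 + \<epsilon>) ^ k * ?E * poly (esym_poly lam n) y"
      using esym_poly_chernoff[of n lam y "1 + \<epsilon>" k] lam y eps kn by (simp add: U_def L_def)
    then have "poly (esym_poly lam n) ((1 + \<epsilon>) * y) / (1 + \<epsilon>) ^ Suc k
        \<le> (1 + \<epsilon>) ^ k * ?E * poly (esym_poly lam n) y / (1 + \<epsilon>) ^ Suc k"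
      using eps by (intro divide_right_mono) auto
    also have "\<dots> = ?E / (1 + \<epsilon>) * poly (esym_poly lam n) y" using eps by simp
    also have "\<dots> \<le> 2*\<epsilon> / (1 + 2*\<epsilon>) * poly (esym_poly lam n) y"
    proof (rule mult_right_mono)
      show "?E / (1 + \<epsilon>) \<le> 2*\<epsilon> / (1 + 2*\<epsilon>)"
        using chernoff_exponent_bound[OF eps _ L] Uw by (simp add: w_def)
      show "0 \<le> poly (esym_poly lam n) y"
        unfolding esym_poly_def poly_prod using pos by (intro prod_nonneg) (auto simp: less_imp_le)
    qed
    finally show ?thesis .
  qed
  have "real (Suc k) * c (Suc k) * (1 - 2*\<epsilon> / (1 + 2*\<epsilon>)) * y \<le> real k * c k"
    unfolding c_def using esym_ratio_bound[OF lam y _ mean tail] eps by simp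
  also have "1 - 2*\<epsilon> / (1 + 2*\<epsilon>) = 1 / (1 + 2*\<epsilon>)" using eps by (simp add: field_simps)
  finally have "real (Suc k) * c (Suc k) * \<kappa> \<le> real k * c k * ((1 + 2*\<epsilon>)\<^sup>2 * \<gamma> * OPT lam n k)"
    using \<gamma> opt0 eps by (simp add: y_def divide_le_eq power2_eq_square mult_ac)
  then have "real (Suc k) * c (Suc k) \<le> real k * c k * ((1 + 2*\<epsilon>)\<^sup>2 * \<gamma> * OPT lam n k) / \<kappa>"
    using \<kappa> by (simp add: le_divide_eq)
  also have "\<dots> = (1 + 2*\<epsilon>)\<^sup>2 * (real k / \<kappa> * \<gamma>) * OPT lam n k * c k" by simp
  also have "real k / \<kappa> = 1 + real s / \<kappa>" using \<kappa> by (simp add: field_simps \<kappa>_def)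
  finally show "real (k + 1) * c (k + 1) \<le>
      (1 + 2*\<epsilon>)\<^sup>2 * ((1 + real s / \<kappa>) * sqrt (1 + 2 * \<kappa> / \<tau>)) * OPT lam n k * c k"
    by (simp add: \<gamma>_def)
qed

section \<open>The k-DPP expectation as a ratio of symmetric polynomials\<close>

theorem theorem1:
  fixes A :: "real^'n^'m" and lam :: "nat \<Rightarrow> real" and s k :: nat and \<epsilon> :: real
  assumes eigs: "sorted_eigs A lam"
    and s_lt: "s < rank A"
    and eps: "0 < \<epsilon>" "\<epsilon> \<le> 1/2"
    and k_lo: "real s + 7 / \<epsilon>^4 * (ln (1/\<epsilon>))^2 \<le> real k"
    and k_hi: "real k \<le> (real s + stable_rank lam CARD('n) s) - 1"
  shows "kdpp_expect A k (Er A) / OPT lam CARD('n) k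
           \<le> (1 + 2*\<epsilon>)^2 *
              ((1 + real s / (real k - real s)) *
               sqrt (1 + 2 * (real k - real s) / ((real s + stable_rank lam CARD('n) s) - real k)))"
    (is "_ \<le> ?C")
proof -
  let ?c = "coeff (esym_poly lam CARD('n))"
  have lam: "\<And>i. i < CARD('n) \<Longrightarrow> 0 \<le> lam i"
    using sorted_eigs_nonneg[OF eigs] .
  have dec: "\<And>i j. i \<le> j \<Longrightarrow> j < CARD('n) \<Longrightarrow> lam j \<le> lam i"
    using eigs unfolding sorted_eigs_def by blast
  have k: "7 / \<epsilon>^4 * (ln (1/\<epsilon>))\<^sup>2 \<le> real k - real s"
    "1 \<le> real s + stable_rank lam CARD('n) s - real k"
    using k_lo k_hi by linarith+
  note bound = esym_ratio_le_OPT[where lam = lam and n = "CARD('n)", OF lam dec eps k]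
  have "0 \<le> 7 / \<epsilon>^4 * (ln (1/\<epsilon>))\<^sup>2" using eps by simp
  then have "0 \<le> real k - real s" using k(1) by linarith
  then have C: "0 \<le> ?C" using k(2)
    by (intro mult_nonneg_nonneg real_sqrt_ge_zero add_nonneg_nonneg divide_nonneg_nonneg) auto
  have "kdpp_expect A k (Er A) = real (k + 1) * ?c (k + 1) / ?c k"
    unfolding kdpp_expect_def by (simp only: sum_gram_det_Er sum_gram_det_eq_coeff[OF eigs])
  also have "\<dots> \<le> ?C * OPT lam CARD('n) k"
  proof (cases "?c k = 0")
    \<comment> \<open>The quotient is 0 by the convention on division, so nonnegativity of the
      right-hand side suffices.\<close>
    case True
    then show ?thesis using C bound(1) by simp
  next
    case False
    then have "0 < ?c k" using coeff_esym_poly_nonneg[where lam = lam and n = "CARD('n)" and k = k, OF lam] by simp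
    then show ?thesis using bound(2) by (simp only: pos_divide_le_eq)
  qed
  finally show ?thesis using bound(1) by (simp only: pos_divide_le_eq)
qed

end
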